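(* For $n\ge 1$, let $\bar W_n$ be the mean number of concurrent runs induced by syntax trees of size $n$, i.e. the arithmetic mean, over all plane rooted trees $T$ of size $n$ (each weighted equally), of the number of concurrent runs of $T$. Then $$\bar W_n=\frac{n!}{2^{n-1}}\ \sim_{n\to\infty}\ 2\sqrt{2\pi n}\left(\frac{n}{2e}\right)^n .$$
   Context: A syntax tree (process tree) is a plane rooted tree, i.e. a rooted tree in which the children of each node are linearly ordered; its size is its number of nodes. The nodes of a given tree are regarded as carrying pairwise distinct names (actions), but trees are enumerated up to isomorphism of plane rooted trees (unlabelled). For a plane rooted tree $T$ whose root has children $v_1,\dots,v_r$ from left to right, and $1\le i\le r$, the $i$-contraction $T\lhd i$ is the plane tree with root $v_i$ whose root-subtrees are, from left to right, $T(v_1),\dots,T(v_{i-1}),T(v_{i_1}),\dots,T(v_{i_m}),T(v_{i+1}),\dots,T(v_r)$, where $T(v)$ is the subtree of all descendants of $v$ (including $v$) and $v_{i_1},\dots,v_{i_m}$ are the children of $v_i$ in order. The semantic tree $\mathrm{Sem}(T)$ is defined recursively: if $T$ is a single node, $\mathrm{Sem}(T)=T$; if $T$ has root $t$ with $r\ge1$ children, $\mathrm{Sem}(T)$ has root $t$ and root-subtrees $\mathrm{Sem}(T\lhd 1),\dots,\mathrm{Sem}(T\lhd r)$ from left to right. A concurrent run of $T$ is a branch of $\mathrm{Sem}(T)$ (path from the root to a leaf); the number of concurrent runs of $T$ is thus the number of leaves of $\mathrm{Sem}(T)$. *)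

theory Defs
  imports Complex_Main "HOL-Library.Landau_Symbols"
begin

(* Nodes carry names so that the nodes of the semantic tree can refer to the actions of the
   syntax tree. Enumeration is unlabelled, i.e. over unit-labelled trees; the number of runs
   does not depend on the names (lemma num_runs_map_tree). *)

datatype 'a tree = Node (label: 'a) (subtrees: "'a tree list")

type_synonym plane_tree = "unit tree"

(* The number of nodes; the function size generated by the datatype package counts
   list constructors as well. *)

primrec num_nodes :: "'a tree \<Rightarrow> nat" where
  "num_nodes (Node a ts) = Suc (sum_list (map num_nodes ts))"

(* Positions i are counted from 1; the value is meaningful for 1 <= i <= length ts only. *)

fun contract :: "'a tree \<Rightarrow> nat \<Rightarrow> 'a tree" (infixl "\<lhd>" 70) where
  "Node a ts \<lhd> i =
     Node (label (ts ! (i - 1))) (take (i - 1) ts @ subtrees (ts ! (i - 1)) @ drop i ts)"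

lemma num_nodes_contract:
  assumes "1 \<le> i" "i \<le> length ts"
  shows "num_nodes (Node a ts) = Suc (num_nodes (Node a ts \<lhd> i))"
proof -
  have "take (i - 1) ts @ ts ! (i - 1) # drop i ts = ts"
    using id_take_nth_drop[of "i - 1" ts] assms by simp
  then have "sum_list (map num_nodes ts) =
      sum_list (map num_nodes (take (i - 1) ts @ ts ! (i - 1) # drop i ts))"
    by simp
  then show ?thesis
    by (cases "ts ! (i - 1)") simp
qed

(* The equation covers the single node, for which the list of positions is empty. *)

function sem :: "'a tree \<Rightarrow> 'a tree" where
  "sem (Node a ts) = Node a (map (\<lambda>i. sem (Node a ts \<lhd> i)) [1..<Suc (length ts)])"
  by pat_completeness auto
termination
proof (relation "measure num_nodes")
  fix a :: 'a and ts :: "'a tree list" and i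
  assume "i \<in> set [1..<Suc (length ts)]"
  then have "1 \<le> i" "i \<le> length ts"
    by auto
  from num_nodes_contract[OF this, of a]
  show "(Node a ts \<lhd> i, Node a ts) \<in> measure num_nodes"
    by (simp del: contract.simps num_nodes.simps)
qed simp

declare sem.simps [simp del] (* loops together with contract.simps *)

(* Root-to-leaf paths, from left to right, each as the sequence of its node names. Being a list,
   it has one entry for every path, even when names coincide. *)

fun branches :: "'a tree \<Rightarrow> 'a list list" where
  "branches (Node a []) = [[a]]"
| "branches (Node a (t # ts)) = map ((#) a) (concat (map branches (t # ts)))"

definition concurrent_runs :: "'a tree \<Rightarrow> 'a list list" where
  "concurrent_runs T = branches (sem T)"

definition num_runs :: "'a tree \<Rightarrow> nat" where
  "num_runs T = length (concurrent_runs T)"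

definition trees_of_size :: "nat \<Rightarrow> plane_tree set" where
  "trees_of_size n = {T. num_nodes T = n}"

definition mean_runs :: "nat \<Rightarrow> real" where
  "mean_runs n = (\<Sum>T\<in>trees_of_size n. real (num_runs T)) / real (card (trees_of_size n))"

fun num_leaves :: "'a tree \<Rightarrow> nat" where
  "num_leaves (Node a []) = 1"
| "num_leaves (Node a (t # ts)) = sum_list (map num_leaves (t # ts))"

lemma length_branches: "length (branches t) = num_leaves t"
proof (induction t rule: branches.induct)
  case (2 a t ts)
  then show ?case
    by (simp add: length_concat comp_def cong: map_cong)
qed simp

lemma num_runs_eq_num_leaves: "num_runs T = num_leaves (sem T)"
  by (simp add: num_runs_def concurrent_runs_def length_branches)

lemma num_leaves_map_tree: "num_leaves (map_tree f t) = num_leaves t"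
proof (induction t rule: num_leaves.induct)
  case (2 a t ts)
  then show ?case
    by (simp add: comp_def cong: map_cong)
qed simp

lemma contract_map_tree:
  assumes "1 \<le> i" "i \<le> length ts"
  shows "map_tree f (Node a ts) \<lhd> i = map_tree f (Node a ts \<lhd> i)"
  using assms by (cases "ts ! (i - 1)") (simp add: take_map drop_map)

lemma sem_map_tree: "sem (map_tree f t) = map_tree f (sem t)"
proof (induction t rule: sem.induct)
  case (1 a ts)
  have "sem (Node (f a) (map (map_tree f) ts) \<lhd> i) = map_tree f (sem (Node a ts \<lhd> i))"
    if "i \<in> set [1..<Suc (length ts)]" for i
  proof -
    have "1 \<le> i" "i \<le> length ts"
      using that by auto
    then show ?thesis
      using 1[OF that] contract_map_tree[of i ts f a] by (simp del: contract.simps)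
  qed
  then show ?case
    by (simp add: sem.simps del: contract.simps upt_Suc)
qed

lemma num_runs_map_tree: "num_runs (map_tree f t) = num_runs t"
  by (simp add: num_runs_eq_num_leaves sem_map_tree num_leaves_map_tree)

lemma finite_trees_of_size: "finite (trees_of_size n)"
proof (induction n rule: less_induct)
  case (less n)
  define A where "A = (\<Union>m<n. trees_of_size m)"
  have fin: "finite A"
    unfolding A_def using less by blast
  have "T \<in> Node () ` {ts. set ts \<subseteq> A \<and> length ts \<le> n}" if T: "num_nodes T = n" for T
  proof (cases T)
    case (Node a ts)
    have "num_nodes t < n" if "t \<in> set ts" for t
      using T member_le_sum_list[of "num_nodes t" "map num_nodes ts"] that
      by (auto simp: Node)
    then have "set ts \<subseteq> A"
      by (auto simp: A_def trees_of_size_def)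
    moreover have "length ts \<le> sum_list (map num_nodes ts)" for ts :: "unit tree list"
    proof (induction ts)
      case (Cons t ts)
      then show ?case by (cases t) simp
    qed simp
    from this[of ts] have "length ts \<le> n"
      using T by (simp add: Node)
    ultimately show ?thesis
      by (simp add: Node)
  qed
  then have "trees_of_size n \<subseteq> Node () ` {ts. set ts \<subseteq> A \<and> length ts \<le> n}"
    by (auto simp: trees_of_size_def)
  moreover have "finite (Node () ` {ts. set ts \<subseteq> A \<and> length ts \<le> n})"
    using fin by (intro finite_imageI finite_lists_length_le)
  ultimately show ?case
    by (rule finite_subset)
qed

end

(* For 1 <= i <= r, contraction at i is a bijection from the trees with n + 1 nodes and root degree r
   onto the trees with n nodes and root degree at least r - 1. Hence the number of trees, and the
   total number of runs, over the trees of given size and root degree at least s satisfy two-term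
   recurrences, which are solved by
   (s + 1) (2k + s)! / ((k + s + 1)! k!)  and  (2k + s)! / (2^k k!)  for trees of size k + s + 1.
   At s = 0 their quotient is the mean. Stirling's formula follows from Wallis's product once
   n! / (sqrt n (n/e)^n) is known to converge, which holds because the differences of its logarithm
   are O(1/n^2). *)

theory Submission
  imports Defs "HOL-Analysis.Gamma_Function" "HOL-Real_Asymp.Real_Asymp"
begin

section \<open>Plane trees graded by root degree, and contraction as a bijection\<close>

definition tail_trees :: "nat \<Rightarrow> nat \<Rightarrow> plane_tree set" where
  "tail_trees n s = {T \<in> trees_of_size n. s \<le> length (subtrees T)}"

definition degree_trees :: "nat \<Rightarrow> nat \<Rightarrow> plane_tree set" where
  "degree_trees n r = {T \<in> trees_of_size n. length (subtrees T) = r}"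

lemma num_nodes_pos: "0 < num_nodes T"
  by (cases T) simp

lemma length_le_sum_num_nodes: "length ts \<le> sum_list (map num_nodes ts)"
proof (induction ts)
  case (Cons t ts)
  with num_nodes_pos[of t] show ?case by simp
qed simp

lemma degree_less_num_nodes: "length (subtrees T) < num_nodes T"
  using length_le_sum_num_nodes by (cases T) (simp add: less_Suc_eq_le)

lemma finite_tail_trees: "finite (tail_trees n s)"
  unfolding tail_trees_def using finite_trees_of_size[of n] by simp

lemma finite_degree_trees: "finite (degree_trees n r)"
  unfolding degree_trees_def using finite_trees_of_size[of n] by simp

lemma tail_trees_empty:
  assumes "n \<le> s"
  shows "tail_trees n s = {}"
proof -
  have "\<not> s \<le> length (subtrees T)" if "num_nodes T = n" for T :: plane_tree
    using degree_less_num_nodes[of T] that assms by linarith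
  then show ?thesis by (auto simp: tail_trees_def trees_of_size_def)
qed

lemma sum_tail_trees:
  "(\<Sum>T\<in>tail_trees n s. f T) =
    (\<Sum>T\<in>degree_trees n s. f T) + (\<Sum>T\<in>tail_trees n (Suc s). f T)"
proof -
  have "tail_trees n s = degree_trees n s \<union> tail_trees n (Suc s)"
    "degree_trees n s \<inter> tail_trees n (Suc s) = {}"
    by (auto simp: tail_trees_def degree_trees_def)
  then show ?thesis
    by (simp add: sum.union_disjoint finite_degree_trees finite_tail_trees)
qed

lemma degree_trees_0: "degree_trees (Suc n) 0 = (if n = 0 then {Node () []} else {})"
proof -
  have "T \<in> degree_trees (Suc n) 0 \<longleftrightarrow> n = 0 \<and> T = Node () []" for T
    by (cases T) (auto simp: degree_trees_def trees_of_size_def)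
  then show ?thesis by auto
qed

text \<open>The root degree of \<open>T \<lhd> i\<close> reveals how many children the i-th child of the root of \<open>T\<close> had,
  so the contraction can be undone once the root degree of \<open>T\<close> is known.\<close>

lemma bij_betw_contract:
  assumes i: "1 \<le> i" "i \<le> Suc s"
  shows "bij_betw (\<lambda>T. T \<lhd> i) (degree_trees (Suc n) (Suc s)) (tail_trees n s)"
proof -
  \<comment> \<open>Contraction trades one of \<open>s + 1\<close> root children for
    \<open>m\<close> grandchildren, so \<open>m\<close> is the excess of the new degree over
    \<open>s\<close>. Unit labels make the discarded root name irrelevant.\<close>
  define expand :: "plane_tree \<Rightarrow> plane_tree" where
    "expand T = (let ts = subtrees T; m = length ts - s in
       Node () (take (i - 1) ts @ Node () (take m (drop (i - 1) ts)) # drop (i - 1 + m) ts))" for T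
  show ?thesis
  proof (rule bij_betw_byWitness[where f' = expand])
    have "expand (T \<lhd> i) = T" "T \<lhd> i \<in> tail_trees n s"
      if "T \<in> degree_trees (Suc n) (Suc s)" for T
    proof -
      obtain ts where T: "T = Node () ts" by (cases T) auto
      with that have len: "length ts = Suc s" and nodes: "num_nodes T = Suc n"
        by (auto simp: degree_trees_def trees_of_size_def)
      obtain us where us: "ts ! (i - 1) = Node () us" by (cases "ts ! (i - 1)") auto
      have "take (i - 1) ts @ ts ! (i - 1) # drop i ts = ts"
        using id_take_nth_drop[of "i - 1" ts] i len by simp
      then show "expand (T \<lhd> i) = T"
        using i len us by (simp add: T expand_def)
      have "num_nodes (T \<lhd> i) = n"
        using num_nodes_contract[of i ts "()"] i len nodes T by simp
      then show "T \<lhd> i \<in> tail_trees n s"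
        using i len by (auto simp: T tail_trees_def trees_of_size_def)
    qed
    then show "\<forall>T\<in>degree_trees (Suc n) (Suc s). expand (T \<lhd> i) = T"
      "(\<lambda>T. T \<lhd> i) ` degree_trees (Suc n) (Suc s) \<subseteq> tail_trees n s"
      by auto
    have "expand T \<lhd> i = T" "expand T \<in> degree_trees (Suc n) (Suc s)"
      if "T \<in> tail_trees n s" for T
    proof -
      obtain ts where T: "T = Node () ts" by (cases T) auto
      with that have len: "s \<le> length ts" and nodes: "num_nodes T = n"
        by (auto simp: tail_trees_def trees_of_size_def)
      define m where "m = length ts - s"
      define us where
        "us = take (i - 1) ts @ Node () (take m (drop (i - 1) ts)) # drop (i - 1 + m) ts"
      have expand: "expand T = Node () us"
        by (simp add: expand_def T us_def m_def Let_def)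
      have "us ! (i - 1) = Node () (take m (drop (i - 1) ts))"
        and "take (i - 1) us = take (i - 1) ts" and "drop i us = drop (i - 1 + m) ts"
        using i len by (auto simp: us_def nth_append)
      moreover have "take (i - 1) ts @ take m (drop (i - 1) ts) @ drop (i - 1 + m) ts = ts"
        by (metis append_take_drop_id drop_drop add.commute)
      ultimately show inverse: "expand T \<lhd> i = T"
        unfolding expand by (simp add: T)
      have length: "length us = Suc s"
        using i len by (simp add: us_def m_def)
      \<comment> \<open>The size is read off from the contraction, which is already known to be
        \<open>T\<close>.\<close>
      have "num_nodes (expand T) = Suc (num_nodes (expand T \<lhd> i))"
        using num_nodes_contract[of i us "()"] i length by (simp only: expand)
      then have "num_nodes (expand T) = Suc n"
        by (simp only: inverse nodes)
      then show "expand T \<in> degree_trees (Suc n) (Suc s)"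
        using length by (simp add: expand degree_trees_def trees_of_size_def)
    qed
    then show "\<forall>T\<in>tail_trees n s. expand T \<lhd> i = T"
      "expand ` tail_trees n s \<subseteq> degree_trees (Suc n) (Suc s)"
      by auto
  qed
qed

section \<open>Recurrences for runs and cardinalities, and their closed forms\<close>

lemma num_runs_leaf: "num_runs (Node a []) = 1"
  by (simp add: num_runs_eq_num_leaves sem.simps)

text \<open>The root-subtrees of \<open>sem\<close> are the semantic trees of the contractions, and
  they share out its leaves. A single node is itself a leaf, whereas the sum would be 0.\<close>

lemma num_runs_rec:
  assumes "ts \<noteq> []"
  shows "num_runs (Node a ts) = (\<Sum>i=1..length ts. num_runs (Node a ts \<lhd> i))"
proof -
  have "num_leaves (Node a us) = sum_list (map num_leaves us)" if "us \<noteq> []" for us :: "'a tree list"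
    using that by (cases us) auto
  with assms show ?thesis
    by (simp add: num_runs_eq_num_leaves sem.simps[of a ts] comp_def interv_sum_list_conv_sum_set_nat
        atLeastLessThanSuc_atLeastAtMost del: contract.simps upt_Suc)
qed

text \<open>After exchanging the sums, each of the \<open>s + 1\<close> positions contributes the
  same amount, since every contraction is a bijection onto the same set.\<close>

lemma sum_num_runs_degree_trees:
  "(\<Sum>T\<in>degree_trees (Suc n) (Suc s). num_runs T) = Suc s * (\<Sum>T\<in>tail_trees n s. num_runs T)"
proof -
  have "(\<Sum>T\<in>degree_trees (Suc n) (Suc s). num_runs T) =
      (\<Sum>T\<in>degree_trees (Suc n) (Suc s). \<Sum>i=1..Suc s. num_runs (T \<lhd> i))"
  proof (rule sum.cong)
    fix T assume T: "T \<in> degree_trees (Suc n) (Suc s)"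
    obtain ts where ts: "T = Node () ts" by (cases T) auto
    with T have "length ts = Suc s" by (simp add: degree_trees_def)
    with num_runs_rec[of ts "()"] ts show "num_runs T = (\<Sum>i=1..Suc s. num_runs (T \<lhd> i))"
      by (metis length_0_conv nat.distinct(1))
  qed simp
  also have "\<dots> = (\<Sum>i=1..Suc s. \<Sum>T\<in>degree_trees (Suc n) (Suc s). num_runs (T \<lhd> i))"
    by (rule sum.swap)
  also have "\<dots> = (\<Sum>i=1..Suc s. \<Sum>T\<in>tail_trees n s. num_runs T)"
    by (intro sum.cong sum.reindex_bij_betw bij_betw_contract) auto
  finally show ?thesis by simp
qed

lemma card_degree_trees: "card (degree_trees (Suc n) (Suc s)) = card (tail_trees n s)"
  by (rule bij_betw_same_card[OF bij_betw_contract[of 1]]) auto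

text \<open>Serves runs (\<open>w s = s + 1\<close>) and cardinalities (\<open>w s = 1\<close>)
  alike. Root degree exactly \<open>s\<close> contracts to \<open>(k, s - 1)\<close>; larger degrees
  are the case \<open>(k - 1, s + 1)\<close>. The first term is absent for \<open>s = 0\<close>
  unless the tree is a single node, the second for \<open>k = 0\<close>.\<close>

lemma sum_tail_trees_eqI:
  fixes f :: "plane_tree \<Rightarrow> real" and w :: "nat \<Rightarrow> real" and F :: "nat \<Rightarrow> nat \<Rightarrow> real"
  assumes leaf: "f (Node () []) = 1"
    and degree: "\<And>n s. (\<Sum>T\<in>degree_trees (Suc n) (Suc s). f T) = w s * (\<Sum>T\<in>tail_trees n s. f T)"
    and F: "F 0 0 = 1" "\<And>k. F (Suc k) 0 = F k 1" "\<And>s. F 0 (Suc s) = w s * F 0 s"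
      "\<And>k s. F (Suc k) (Suc s) = w s * F (Suc k) s + F k (Suc (Suc s))"
  shows "(\<Sum>T\<in>tail_trees (Suc (k + s)) s. f T) = F k s"
\<comment> \<open>Lowering \<open>k\<close> raises \<open>s\<close> by one, so \<open>k\<close>
  needs weight 2; both recursive calls then lower the measure by one.\<close>
proof (induction "2 * k + s" arbitrary: k s rule: less_induct)
  case less
  show ?case
  proof (cases s)
    case 0
    show ?thesis
    proof (cases k)
      case (Suc k')
      then show ?thesis
        using less[of k' 1] 0 by (simp add: sum_tail_trees[of _ _ 0] degree_trees_0 F)
    qed (simp add: 0 sum_tail_trees[of _ _ 0] degree_trees_0 tail_trees_empty leaf F)
  next
    case (Suc s')
    have IH: "(\<Sum>T\<in>tail_trees (Suc (k + s')) s'. f T) = F k s'"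
      using less[of k s'] Suc by simp
    show ?thesis
    proof (cases k)
      case 0
      then show ?thesis
        using IH Suc by (simp add: sum_tail_trees[of _ _ "Suc s'"] tail_trees_empty degree F)
    next
      case k: (Suc k')
      then show ?thesis
        using IH less[of k' "Suc (Suc s')"] Suc
        by (simp add: sum_tail_trees[of _ _ "Suc s'"] degree F)
    qed
  qed
qed

lemma sum_num_runs_tail_trees:
  "(\<Sum>T\<in>tail_trees (Suc (k + s)) s. real (num_runs T)) = fact (2 * k + s) / (2 ^ k * fact k)"
proof (rule sum_tail_trees_eqI[where w = "\<lambda>s. real (Suc s)"])
  fix n s
  show "(\<Sum>T\<in>degree_trees (Suc n) (Suc s). real (num_runs T)) =
      real (Suc s) * (\<Sum>T\<in>tail_trees n s. real (num_runs T))"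
    using arg_cong[OF sum_num_runs_degree_trees[of n s], of real] by (simp add: algebra_simps)
next
  fix k s
  \<comment> \<open>With all terms over the same factorial, the recurrence becomes
    \<open>2k + s + 3 = (s + 1) + 2(k + 1)\<close>.\<close>
  have "fact (2 * Suc k + Suc s) = (real (2 * k + s) + 3) * fact (2 * k + s + 2)"
    by (simp add: numeral_eq_Suc algebra_simps del: fact_Suc) (simp add: algebra_simps)
  then show "fact (2 * Suc k + Suc s) / (2 ^ Suc k * fact (Suc k)) =
      real (Suc s) * (fact (2 * Suc k + s) / (2 ^ Suc k * fact (Suc k))) +
      fact (2 * k + Suc (Suc s)) / (2 ^ k * fact k)"
    by (simp add: divide_simps del: fact_Suc) (simp add: algebra_simps)
next
  fix k
  show "fact (2 * Suc k + 0) / (2 ^ Suc k * fact (Suc k)) = (fact (2 * k + 1) / (2 ^ k * fact k) :: real)"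
    by (simp add: divide_simps)
qed (simp_all add: num_runs_leaf field_simps)

text \<open>These are the ballot numbers \<open>(s + 1) / (k + s + 1) * ((2k + s) choose k)\<close>,
  at \<open>s = 0\<close> the Catalan numbers.\<close>

lemma card_tail_trees:
  "real (card (tail_trees (Suc (k + s)) s)) =
    real (Suc s) * fact (2 * k + s) / (fact (Suc (k + s)) * fact k)"
proof -
  have "(\<Sum>T\<in>tail_trees (Suc (k + s)) s. 1::real) =
    real (Suc s) * fact (2 * k + s) / (fact (Suc (k + s)) * fact k)"
  proof (rule sum_tail_trees_eqI[where w = "\<lambda>s. 1"])
    fix k s
    \<comment> \<open>The recurrence with its factorials abstracted to \<open>A\<close>,
      \<open>B\<close>, \<open>C\<close>; it amounts to
      \<open>(s + 2)(2k + s + 3) = (s + 1)(k + s + 3) + (s + 3)(k + 1)\<close>.\<close>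
    have identity: "(s + 2) * ((2 * k + s + 3) * A) / ((k + s + 3) * B * ((k + 1) * C)) =
        (s + 1) * A / (B * ((k + 1) * C)) + (s + 3) * A / ((k + s + 3) * B * C)"
      if "k \<ge> 0" "s \<ge> 0" "B > 0" "C > 0" for k s A B C :: real
    proof -
      have "k + 1 \<noteq> 0" "k + s + 3 \<noteq> 0" "B \<noteq> 0" "C \<noteq> 0"
        using that by auto
      then show ?thesis
        by (simp add: divide_simps) (simp add: algebra_simps)
    qed
    have "fact (2 * Suc k + Suc s) = (2 * real k + real s + 3) * fact (2 * k + s + 2)"
      "fact (Suc (Suc k + Suc s)) = (real k + real s + 3) * fact (k + s + 2)"
      "fact (Suc k) = (real k + 1) * fact k"
      by (simp_all add: numeral_eq_Suc algebra_simps del: fact_Suc) (simp_all add: algebra_simps)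
    moreover have "fact (2 * Suc k + s) = (fact (2 * k + s + 2) :: real)"
      "fact (2 * k + Suc (Suc s)) = (fact (2 * k + s + 2) :: real)"
      "fact (Suc (Suc k + s)) = (fact (k + s + 2) :: real)"
      "fact (Suc (k + Suc (Suc s))) = (fact (Suc (Suc k + Suc s)) :: real)"
      by (simp_all add: numeral_eq_Suc del: fact_Suc)
    ultimately show "real (Suc (Suc s)) * fact (2 * Suc k + Suc s) / (fact (Suc (Suc k + Suc s)) * fact (Suc k)) =
        1 * (real (Suc s) * fact (2 * Suc k + s) / (fact (Suc (Suc k + s)) * fact (Suc k))) +
        real (Suc (Suc (Suc s))) * fact (2 * k + Suc (Suc s)) / (fact (Suc (k + Suc (Suc s))) * fact k)"
      using identity[of k s "fact (k + s + 2)" "fact k" "fact (2 * k + s + 2)"]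
      by (simp add: add_ac del: fact_Suc)
  next
    fix k
    have "fact (2 * Suc k + 0) = 2 * (real k + 1) * fact (2 * k + 1)"
      "fact (Suc k) = (real k + 1) * fact k"
      by (simp_all add: algebra_simps)
    moreover have "fact (Suc (Suc k + 0)) = (fact (Suc (k + 1)) :: real)"
      by simp
    ultimately show "real (Suc 0) * fact (2 * Suc k + 0) / (fact (Suc (Suc k + 0)) * fact (Suc k)) =
        real (Suc 1) * fact (2 * k + 1) / (fact (Suc (k + 1)) * fact k)"
      by (simp add: divide_simps del: fact_Suc)
  next
    fix s
    \<comment> \<open>At \<open>k = 0\<close> only the root with \<open>s\<close> leaves is
      counted.\<close>
    have "real (Suc n) * fact n / (fact (Suc n)) = 1" for n
      by (simp del: of_nat_Suc)
    then show "real (Suc (Suc s)) * fact (2 * 0 + Suc s) / (fact (Suc (0 + Suc s)) * fact 0) =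
        1 * (real (Suc s) * fact (2 * 0 + s) / (fact (Suc (0 + s)) * fact 0))"
      by (simp del: fact_Suc of_nat_Suc)
  qed (simp_all add: card_degree_trees)
  then show ?thesis by simp
qed

lemma mean_runs_eq:
  assumes "1 \<le> n"
  shows "mean_runs n = fact n / 2 ^ (n - 1)"
proof -
  obtain k where n: "n = Suc k" using assms by (cases n) auto
  have "tail_trees n 0 = trees_of_size n"
    by (simp add: tail_trees_def)
  then show ?thesis
    using sum_num_runs_tail_trees[of k 0] card_tail_trees[of k 0]
    by (simp add: mean_runs_def n)
qed

section \<open>Stirling's formula from Wallis's product\<close>

definition stirling_ratio :: "nat \<Rightarrow> real" where
  "stirling_ratio n = fact n / (sqrt (real n) * (real n / exp 1) ^ n)"

lemma stirling_ratio_pos: "0 < n \<Longrightarrow> 0 < stirling_ratio n"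
  by (simp add: stirling_ratio_def)

lemma ln_stirling_ratio:
  assumes "0 < n"
  shows "ln (stirling_ratio n) = ln (fact n) - (real n + 1 / 2) * ln (real n) + real n"
  using assms
  by (simp add: stirling_ratio_def ln_div ln_mult ln_sqrt ln_realpow algebra_simps)

lemma stirling_ratio_convergent: "\<exists>c>0. stirling_ratio \<longlonglongrightarrow> c"
proof -
  \<comment> \<open>The shift avoids index 0, where the ratio is 0 by division by zero and
    \<open>exp\<close> would not undo \<open>ln\<close>.\<close>
  define f where "f n = ln (stirling_ratio (Suc n))" for n
  have "f (Suc n) - f n = 1 + (real n + 3 / 2) * (ln (real n + 1) - ln (real n + 2))" for n
  proof -
    have "ln (fact (Suc (Suc n))) = ln (real n + 2) + ln (fact (Suc n))"
      by (subst fact_Suc) (simp add: ln_mult add.commute del: fact_Suc)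
    then show ?thesis
      by (simp add: f_def ln_stirling_ratio algebra_simps del: fact_Suc)
  qed
  \<comment> \<open>Normalising by \<open>sqrt n\<close> is what makes the terms of order
    \<open>1/n\<close> cancel; the leading term left is \<open>-1/(12 n^2)\<close>.\<close>
  moreover have "(\<lambda>n. 1 + (real n + 3 / 2) * (ln (real n + 1) - ln (real n + 2)))
      \<in> O(\<lambda>n. 1 / real n ^ 2)"
    by real_asymp
  ultimately have "(\<lambda>n. f (Suc n) - f n) \<in> O(\<lambda>n. 1 / real n ^ 2)"
    by simp
  moreover have "summable (\<lambda>n. norm (1 / real n ^ 2))"
    using inverse_power_summable[of 2, where ?'a = real] by (simp add: inverse_eq_divide)
  ultimately have "summable (\<lambda>n. f (Suc n) - f n)"
    by (rule summable_comparison_test_bigo[rotated])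
  then have "(\<lambda>n. (\<Sum>i<n. f (Suc i) - f i) + f 0) \<longlonglongrightarrow> suminf (\<lambda>n. f (Suc n) - f n) + f 0"
    by (intro tendsto_intros summable_LIMSEQ)
  then obtain l where "f \<longlonglongrightarrow> l"
    by (auto simp: sum_lessThan_telescope)
  then have "(\<lambda>n. exp (f n)) \<longlonglongrightarrow> exp l"
    by (rule tendsto_exp)
  then have "stirling_ratio \<longlonglongrightarrow> exp l"
    by (simp add: f_def stirling_ratio_pos filterlim_sequentially_Suc)
  then show ?thesis by (metis exp_gt_zero)
qed

text \<open>As \<open>4k^2 - 1 = (2k - 1)(2k + 1)\<close>, the product is the square of
  \<open>(2n)!! / (2n - 1)!!\<close> over \<open>2n + 1\<close>, and that quotient is
  \<open>4^n / (2n choose n)\<close>.\<close>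

lemma wallis_prod_eq_fact:
  "(\<Prod>k=1..n. (4 * real k ^ 2) / (4 * real k ^ 2 - 1)) =
    (2 ^ (2 * n) * fact n ^ 2 / fact (2 * n)) ^ 2 / (2 * real n + 1)"
proof (induction n)
  case (Suc n)
  define x where "x = 2 ^ (2 * n) * fact n ^ 2 / (fact (2 * n) :: real)"
  define y where "y = 2 * real n + 1"
  have y: "y > 0" by (simp add: y_def add_pos_nonneg)
  have "2 ^ (2 * Suc n) * fact (Suc n) ^ 2 / fact (2 * Suc n) = x * ((y + 1) / y)"
    by (simp add: x_def y_def power2_eq_square divide_simps) (simp add: algebra_simps)
  moreover have "4 * real (Suc n) ^ 2 = (y + 1) ^ 2" "4 * real (Suc n) ^ 2 - 1 = y * (y + 2)"
    "2 * real (Suc n) + 1 = y + 2"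
    by (simp_all add: y_def power2_eq_square algebra_simps)
  moreover have "x ^ 2 / y * ((y + 1) ^ 2 / (y * (y + 2))) = (x * ((y + 1) / y)) ^ 2 / (y + 2)"
    using y by (simp add: power2_eq_square mult_ac)
  ultimately show ?case
    using Suc by (simp add: x_def [symmetric] y_def [symmetric] del: of_nat_Suc fact_Suc power_Suc mult_Suc_right)
qed simp

text \<open>The powers of \<open>n/e\<close> and of 2 cancel between \<open>n!^2\<close> and
  \<open>(2n)!\<close>, so besides the ratios only square roots survive.\<close>

lemma stirling_ratio_wallis:
  assumes "0 < n"
  shows "(\<Prod>k=1..n. (4 * real k ^ 2) / (4 * real k ^ 2 - 1)) =
    (stirling_ratio n ^ 2 / stirling_ratio (2 * n)) ^ 2 * (real n / (2 * (2 * real n + 1)))"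
proof -
  define x where "x = (real n / exp 1) ^ n"
  have x: "x > 0" using assms by (simp add: x_def)
  have fact_n: "fact n = stirling_ratio n * sqrt (real n) * x"
    using assms by (simp add: stirling_ratio_def x_def)
  have "(real (2 * n) / exp 1) ^ (2 * n) = 2 ^ (2 * n) * x ^ 2"
    unfolding x_def by (simp add: power_divide power_mult_distrib power_mult [symmetric] mult.commute)
  then have "fact (2 * n) = stirling_ratio (2 * n) * sqrt (2 * real n) * (2 ^ (2 * n) * x ^ 2)"
    using assms x by (simp add: stirling_ratio_def)
  then have "2 ^ (2 * n) * fact n ^ 2 / fact (2 * n) =
      stirling_ratio n ^ 2 / stirling_ratio (2 * n) * (real n / sqrt (2 * real n))"
    using x assms stirling_ratio_pos[of "2 * n"]
    by (simp add: fact_n power_mult_distrib field_simps)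
  moreover have "(real n / sqrt (2 * real n)) ^ 2 = real n / 2"
    using assms by (simp add: power_divide power2_eq_square)
  ultimately show ?thesis
    unfolding wallis_prod_eq_fact by (simp only: power_mult_distrib) simp
qed

text \<open>The ratios at \<open>n\<close> and \<open>2n\<close> share the limit \<open>c\<close>,
  so Wallis's product tends to \<open>(c^2/c)^2 / 4\<close>, which forces
  \<open>c^2 / 4 = pi / 2\<close>.\<close>

lemma stirling_ratio_tendsto: "stirling_ratio \<longlonglongrightarrow> sqrt (2 * pi)"
proof -
  obtain c where c: "c > 0" and lim: "stirling_ratio \<longlonglongrightarrow> c"
    using stirling_ratio_convergent by auto
  have "(\<lambda>n. stirling_ratio (2 * n)) \<longlonglongrightarrow> c"
    by (rule filterlim_compose[OF lim]) real_asymp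
  then have "(\<lambda>n. (stirling_ratio n ^ 2 / stirling_ratio (2 * n)) ^ 2) \<longlonglongrightarrow> (c ^ 2 / c) ^ 2"
    using c by (intro tendsto_intros lim) auto
  moreover have "(\<lambda>n. real n / (2 * (2 * real n + 1))) \<longlonglongrightarrow> 1 / 4"
    by real_asymp
  ultimately have "(\<lambda>n. (stirling_ratio n ^ 2 / stirling_ratio (2 * n)) ^ 2 *
      (real n / (2 * (2 * real n + 1)))) \<longlonglongrightarrow> (c ^ 2 / c) ^ 2 * (1 / 4)"
    by (rule tendsto_mult)
  moreover have "\<forall>\<^sub>F n in sequentially. (stirling_ratio n ^ 2 / stirling_ratio (2 * n)) ^ 2 *
      (real n / (2 * (2 * real n + 1))) = (\<Prod>k=1..n. (4 * real k ^ 2) / (4 * real k ^ 2 - 1))"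
    using eventually_gt_at_top[of 0] by eventually_elim (simp only: stirling_ratio_wallis)
  ultimately have "(\<lambda>n. \<Prod>k=1..n. (4 * real k ^ 2) / (4 * real k ^ 2 - 1)) \<longlonglongrightarrow> (c ^ 2 / c) ^ 2 * (1 / 4)"
    by (rule Lim_transform_eventually)
  then have "(c ^ 2 / c) ^ 2 * (1 / 4) = pi / 2"
    using wallis LIMSEQ_unique by blast
  then have "c ^ 2 = 2 * pi"
    using c by (simp add: power2_eq_square)
  then have "c = sqrt (2 * pi)"
    using c by (metis less_eq_real_def real_sqrt_unique)
  with lim show ?thesis by simp
qed

theorem theorem12:
  shows "(\<forall>n\<ge>1. mean_runs n = fact n / 2 ^ (n - 1)) \<and>
    mean_runs \<sim>[sequentially] (\<lambda>n. 2 * sqrt (2 * pi * real n) * (real n / (2 * exp 1)) ^ n)"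
proof (intro conjI allI impI)
  show "mean_runs \<sim>[sequentially] (\<lambda>n. 2 * sqrt (2 * pi * real n) * (real n / (2 * exp 1)) ^ n)"
  proof (rule asymp_equivI')
    have "(\<lambda>n. stirling_ratio n / sqrt (2 * pi)) \<longlonglongrightarrow> sqrt (2 * pi) / sqrt (2 * pi)"
      by (intro tendsto_intros stirling_ratio_tendsto) simp
    then have "(\<lambda>n. stirling_ratio n / sqrt (2 * pi)) \<longlonglongrightarrow> 1"
      by simp
    moreover have "\<forall>\<^sub>F n in sequentially. stirling_ratio n / sqrt (2 * pi) =
        mean_runs n / (2 * sqrt (2 * pi * real n) * (real n / (2 * exp 1)) ^ n)"
      using eventually_gt_at_top[of 0]
    proof eventually_elim
      case (elim n)
      \<comment> \<open>The exponent \<open>n - 1\<close> in the mean yields the leading factor 2 of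
        the asymptotic form; the remaining \<open>2^n\<close> turns \<open>n/e\<close> into
        \<open>n/(2e)\<close>.\<close>
      then have "(2::real) ^ n = 2 * 2 ^ (n - 1)"
        by (cases n) auto
      then show ?case
        using elim by (simp add: stirling_ratio_def mean_runs_eq real_sqrt_mult power_divide power_mult_distrib)
    qed
    ultimately show "(\<lambda>n. mean_runs n / (2 * sqrt (2 * pi * real n) * (real n / (2 * exp 1)) ^ n)) \<longlonglongrightarrow> 1"
      by (rule Lim_transform_eventually)
  qed
qed (rule mean_runs_eq)

end
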